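(* Fix any positive real number $c$, any positive integer $k$ larger than some absolute constant, and corruption probability $\delta=1/3$. Then any algorithm in the weak-strong oracle model which produces a solution for either $k$-center, $k$-means, or $k$-median that, with probability at least $1/2$, has cost at most $c\cdot\mathrm{OPT}$ (where $\mathrm{OPT}$ is the optimal cost of the clustering task in question on the true metric $d$) must make at least $\Omega(k)$ queries to a strong point oracle, or at least $\Omega(k^2)$ queries to a strong edge oracle.
   Context: Weak-strong oracle model: there is an unknown metric $d$ on a set $\mathcal{X}$ of $n$ points and a corruption probability $\delta$. Independently for each unordered pair, with probability $\delta$ the pair is corrupted (randomness drawn once); the weak oracle returns $\tilde d(x,y)=d(x,y)$ for uncorrupted pairs and an arbitrary value chosen by an adversary (who knows $d$ and the corrupted set) for corrupted pairs. A strong point query on $x$ returns a symbol $\mathrm{SO}(x)$ such that from $\mathrm{SO}(x),\mathrm{SO}(y)$ one can compute $d(x,y)$; a strong edge query on $(x,y)$ returns $d(x,y)$. $k$-center minimizes $\max_p d(p,\mathcal{C}(p))$; $k$-median minimizes $\sum_p d(p,\mathcal{C}(p))$; $k$-means minimizes $\sum_p d(p,\mathcal{C}(p))^2$, over choices of $k$ centers and an assignment $\mathcal{C}$ of points to centers. *)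

theory Defs
  imports "HOL-Probability.Probability"
begin

text \<open>
  The point set of size \<open>n\<close> is \<open>{..<n}\<close>. A metric on it is a function \<open>d\<close> with
  \<open>Metric_space {..<n} d\<close>; its values at arguments outside \<open>{..<n}\<close> carry no meaning, and
  queries about such arguments return meaningless answers.
\<close>

section \<open>Clustering\<close>

datatype objective = KCenter | KMedian | KMeans

text \<open>A solution is a set of centers together with an assignment of points to centers.\<close>

type_synonym solution = "nat set \<times> (nat \<Rightarrow> nat)"

definition solutions :: "nat \<Rightarrow> nat \<Rightarrow> solution set" where
  "solutions n k = {(S, a). S \<subseteq> {..<n} \<and> card S = k \<and> a \<in> {..<n} \<rightarrow> S}"

fun cost :: "objective \<Rightarrow> nat \<Rightarrow> (nat \<Rightarrow> nat \<Rightarrow> real) \<Rightarrow> solution \<Rightarrow> real" where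
  "cost KCenter n d (S, a) = Max ((\<lambda>p. d p (a p)) ` {..<n})"
| "cost KMedian n d (S, a) = (\<Sum>p<n. d p (a p))"
| "cost KMeans n d (S, a) = (\<Sum>p<n. (d p (a p))\<^sup>2)"

definition opt :: "objective \<Rightarrow> nat \<Rightarrow> nat \<Rightarrow> (nat \<Rightarrow> nat \<Rightarrow> real) \<Rightarrow> real" where
  "opt obj n k d = (INF s\<in>solutions n k. cost obj n d s)"

section \<open>Oracles\<close>

definition pairs :: "nat \<Rightarrow> nat set set" where
  "pairs n = {{x, y} | x y. x < n \<and> y < n \<and> x \<noteq> y}"

definition corruption :: "real \<Rightarrow> nat \<Rightarrow> nat set set pmf" where
  "corruption \<delta> n =
     map_pmf (\<lambda>f. {e \<in> pairs n. f e}) (Pi_pmf (pairs n) False (\<lambda>_. bernoulli_pmf \<delta>))"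

text \<open>
  An adversary maps the set of corrupted pairs to the values reported on them. Its knowledge of
  the metric is expressed by quantifying over adversaries after the metric.
\<close>

type_synonym adversary = "nat set set \<Rightarrow> nat set \<Rightarrow> real"

definition weak_oracle ::
  "(nat \<Rightarrow> nat \<Rightarrow> real) \<Rightarrow> adversary \<Rightarrow> nat set set \<Rightarrow> nat \<Rightarrow> nat \<Rightarrow> real" where
  "weak_oracle d adv K x y = (if {x, y} \<in> K then adv K {x, y} else d x y)"

text \<open>
  Symbols returned by the strong point oracle are finite strings of reals. A decoder computes
  distances from symbols; it must not depend on the unknown metric, so every metric has to be
  representable by symbols under the same decoder.
\<close>

type_synonym symbol = "real list"

definition represents ::
  "nat \<Rightarrow> (symbol \<Rightarrow> symbol \<Rightarrow> real) \<Rightarrow> (nat \<Rightarrow> symbol) \<Rightarrow> (nat \<Rightarrow> nat \<Rightarrow> real) \<Rightarrow> bool" where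
  "represents n dec SO d \<longleftrightarrow> (\<forall>x<n. \<forall>y<n. dec (SO x) (SO y) = d x y)"

definition decoder :: "nat \<Rightarrow> (symbol \<Rightarrow> symbol \<Rightarrow> real) \<Rightarrow> bool" where
  "decoder n dec \<longleftrightarrow> (\<forall>d. Metric_space {..<n} d \<longrightarrow> (\<exists>SO. represents n dec SO d))"

lemma ex_decoder: "\<exists>dec. decoder n dec"
proof -
  define dec :: "symbol \<Rightarrow> symbol \<Rightarrow> real" where "dec = (\<lambda>s t. s ! Suc (nat \<lfloor>hd t\<rfloor>))"
  have "represents n dec (\<lambda>x. real x # map (d x) [0..<n]) d" for d
    by (simp add: represents_def dec_def)
  then have "decoder n dec"
    unfolding decoder_def by blast
  then show ?thesis by blast
qed

section \<open>Algorithms\<close>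

text \<open>
  An adaptive randomized algorithm is a decision tree whose continuations receive the answers of
  the oracles; computation between queries is unrestricted. \<open>Random q f\<close> draws internal
  randomness from \<open>q\<close>.
\<close>

datatype algorithm =
    Output solution
  | Weak nat nat "real \<Rightarrow> algorithm"
  | Strong_Point nat "symbol \<Rightarrow> algorithm"
  | Strong_Edge nat nat "real \<Rightarrow> algorithm"
  | Random "nat pmf" "nat \<Rightarrow> algorithm"

text \<open>
  The result of a run is the output together with the number of strong point queries and the
  number of strong edge queries made. Weak queries are free.
\<close>

primrec run ::
  "(nat \<Rightarrow> nat \<Rightarrow> real) \<Rightarrow> (nat \<Rightarrow> symbol) \<Rightarrow> (nat \<Rightarrow> nat \<Rightarrow> real) \<Rightarrow> algorithm
     \<Rightarrow> (solution \<times> nat \<times> nat) pmf" where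
  "run w SO d (Output s) = return_pmf (s, 0, 0)"
| "run w SO d (Weak x y f) = run w SO d (f (w x y))"
| "run w SO d (Strong_Point x f) =
     map_pmf (\<lambda>(s, p, e). (s, Suc p, e)) (run w SO d (f (SO x)))"
| "run w SO d (Strong_Edge x y f) =
     map_pmf (\<lambda>(s, p, e). (s, p, Suc e)) (run w SO d (f (d x y)))"
| "run w SO d (Random q f) = bind_pmf q (\<lambda>i. run w SO d (f i))"

definition execution ::
  "real \<Rightarrow> nat \<Rightarrow> (nat \<Rightarrow> nat \<Rightarrow> real) \<Rightarrow> (nat \<Rightarrow> symbol) \<Rightarrow> adversary \<Rightarrow> algorithm
     \<Rightarrow> (solution \<times> nat \<times> nat) pmf" where
  "execution \<delta> n d SO adv alg =
     bind_pmf (corruption \<delta> n) (\<lambda>K. run (weak_oracle d adv K) SO d alg)"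

text \<open>
  The algorithm is told the decoder, hence it is a function of \<open>dec\<close>. The metric, the symbols
  representing it and the adversary are worst case; the probability is over the corrupted set
  and the internal randomness.
\<close>

definition approximates ::
  "objective \<Rightarrow> real \<Rightarrow> real \<Rightarrow> nat \<Rightarrow> nat \<Rightarrow> ((symbol \<Rightarrow> symbol \<Rightarrow> real) \<Rightarrow> algorithm) \<Rightarrow> bool" where
  "approximates obj c \<delta> n k A \<longleftrightarrow>
     (\<forall>dec d SO adv. decoder n dec \<and> Metric_space {..<n} d \<and> represents n dec SO d \<longrightarrow>
        measure_pmf.prob (execution \<delta> n d SO adv (A dec))
          {(s, p, e). s \<in> solutions n k \<and> cost obj n d s \<le> c * opt obj n k d} \<ge> 1 / 2)"

text \<open>
  Query complexity is worst case: these are the numbers of strong point and strong edge queries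
  that occur in some run, over all inputs, oracles, corrupted sets and internal randomness.
\<close>

definition query_counts ::
  "real \<Rightarrow> nat \<Rightarrow> ((symbol \<Rightarrow> symbol \<Rightarrow> real) \<Rightarrow> algorithm) \<Rightarrow> (nat \<times> nat) set" where
  "query_counts \<delta> n A =
     {(p, e). \<exists>dec d SO adv s. decoder n dec \<and> Metric_space {..<n} d \<and> represents n dec SO d \<and>
        (s, p, e) \<in> set_pmf (execution \<delta> n d SO adv (A dec))}"

end

theory Submission
  imports Defs
begin

text \<open>
  All points outside \<open>{1..k}\<close> form one cluster of tiny diameter \<open>s\<close>, and the points of \<open>{1..k}\<close>
  are at distance 1 from everything, except that one hidden pair \<open>{a, b}\<close> is at distance \<open>s\<close>.
  Up to the choice of centers, the only cheap solution merges \<open>a\<close> and \<open>b\<close>. The adversary reports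
  \<open>s\<close> on every corrupted pair, so that the weak oracle shows the hidden pair as one of about
  \<open>k\<^sup>2 / 6\<close> pairs that look close. The symbols are the rows of the distance matrix, the decoder
  takes the minimum of the two entries, and only the row of \<open>b\<close> mentions the hidden pair. Hence
  the algorithm behaves as without a hidden pair until it queries the point \<open>b\<close> or the edge
  \<open>{a, b}\<close>. Its view is then that of the metric without hidden pair for the corrupted set
  \<open>K \<union> {{a, b}}\<close>, whose law has density at most \<open>1 / \<delta>\<close> with respect to that of \<open>K\<close>. Averaging
  over the ordered pairs \<open>(a, b)\<close> bounds the success probability by
  \<open>(2 k + p k + 2 e) / (\<delta> k (k - 1))\<close>.
\<close>

section \<open>Runs with recorded queries\<close>

text \<open>Counts alone cannot tell whether the hidden pair is exposed; this depends on which
  points and edges are queried.\<close>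

primrec trace ::
  "(nat \<Rightarrow> nat \<Rightarrow> real) \<Rightarrow> (nat \<Rightarrow> symbol) \<Rightarrow> (nat \<Rightarrow> nat \<Rightarrow> real) \<Rightarrow> algorithm
     \<Rightarrow> (solution \<times> nat list \<times> (nat \<times> nat) list) pmf" where
  "trace w SO d (Output s) = return_pmf (s, [], [])"
| "trace w SO d (Weak x y f) = trace w SO d (f (w x y))"
| "trace w SO d (Strong_Point x f) =
     map_pmf (\<lambda>(s, P, E). (s, x # P, E)) (trace w SO d (f (SO x)))"
| "trace w SO d (Strong_Edge x y f) =
     map_pmf (\<lambda>(s, P, E). (s, P, (x, y) # E)) (trace w SO d (f (d x y)))"
| "trace w SO d (Random q f) = bind_pmf q (\<lambda>i. trace w SO d (f i))"

lemma run_eq_map_trace: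
  "run w SO d alg = map_pmf (\<lambda>(s, P, E). (s, length P, length E)) (trace w SO d alg)"
  by (induction alg) (simp_all add: map_bind_pmf pmf.map_comp o_def case_prod_unfold)

lemma prob_bind_pmf:
  "measure_pmf.prob (bind_pmf p f) A = measure_pmf.expectation p (\<lambda>x. measure_pmf.prob (f x) A)"
  unfolding measure_pmf_bind
  by (rule measure_pmf.measure_bind[where N = "count_space UNIV"])
     (use measurable_measure_pmf[of f] in auto)

lemma prob_bind_pmf_mono:
  assumes "\<And>x. measure_pmf.prob (f x) A \<le> measure_pmf.prob (g x) B"
  shows "measure_pmf.prob (bind_pmf p f) A \<le> measure_pmf.prob (bind_pmf p g) B"
proof -
  have "measure_pmf.expectation p (\<lambda>x. measure_pmf.prob (f x) A)
       \<le> measure_pmf.expectation p (\<lambda>x. measure_pmf.prob (g x) B)"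
    by (intro integral_mono measure_pmf.integrable_const_bound[where B = 1] assms) auto
  then show ?thesis by (simp add: prob_bind_pmf)
qed

text \<open>Both runs get the same answers until the first query of the point \<open>b\<close> or of
  the edge between \<open>a\<close> and \<open>b\<close>. Once that happens the event on the right
  is certain, so the runs may diverge freely.\<close>

lemma prob_run_le_prob_trace:
  assumes SO: "\<And>x. x \<noteq> b \<Longrightarrow> SO' x = SO x"
    and d: "\<And>x y. {x, y} \<noteq> {a, b} \<Longrightarrow> d' x y = d x y"
  shows "measure_pmf.prob (run w SO' d' alg) {(s, p, e). good s} \<le>
    measure_pmf.prob (trace w SO d alg)
      {(s, P, E). good s \<or> b \<in> set P \<or> (a, b) \<in> set E \<or> (b, a) \<in> set E}"
proof (induction alg)
  case (Output s)
  then show ?case by (simp add: measure_return_pmf indicator_def)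
next
  case (Weak x y f)
  then show ?case by simp
next
  case (Strong_Point x f)
  show ?case
  proof (cases "x = b")
    case True
    then show ?thesis by (simp add: measure_map_pmf vimage_def case_prod_unfold)
  next
    case False
    with Strong_Point[of "f (SO x)"] SO[of x] show ?thesis
      by (simp add: vimage_def case_prod_unfold)
  qed
next
  case (Strong_Edge x y f)
  show ?case
  proof (cases "{x, y} = {a, b}")
    case True
    then have "(x, y) = (a, b) \<or> (x, y) = (b, a)" by (auto simp: doubleton_eq_iff)
    then show ?thesis by (auto simp: vimage_def case_prod_unfold)
  next
    case False
    with Strong_Edge[of "f (d x y)"] d[of x y] show ?thesis
      by (auto simp: vimage_def case_prod_unfold doubleton_eq_iff)
  qed
next
  case (Random q f)
  then show ?case by (auto intro: prob_bind_pmf_mono)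
qed

section \<open>Forcing a pair to be corrupted\<close>

lemma finite_pairs: "finite (pairs n)"
proof (rule finite_subset)
  show "pairs n \<subseteq> Pow {..<n}" by (auto simp: pairs_def)
qed simp

text \<open>Independently of all other pairs, \<open>e\<close> is corrupted with probability
  \<delta>, and then \<open>insert e K\<close> is \<open>K\<close> itself.\<close>

lemma prob_corruption_insert_le:
  fixes F :: "nat set set \<Rightarrow> 'a pmf"
  assumes e: "e \<in> pairs n" and \<delta>: "0 \<le> \<delta>" "\<delta> \<le> 1"
  shows "\<delta> * measure_pmf.prob (bind_pmf (corruption \<delta> n) (\<lambda>K. F (insert e K))) T
     \<le> measure_pmf.prob (bind_pmf (corruption \<delta> n) F) T"
proof -
  define R where "R = Pi_pmf (pairs n - {e}) False (\<lambda>_. bernoulli_pmf \<delta>)"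
  define L where "L f = {x \<in> pairs n - {e}. f x}" for f :: "nat set \<Rightarrow> bool"
  have ins: "pairs n = insert e (pairs n - {e})" using e by auto
  have L: "{x \<in> pairs n. (f(e := y)) x} = (if y then insert e (L f) else L f)" for f y
    using e by (auto simp: L_def)
  have "Pi_pmf (pairs n) False (\<lambda>_. bernoulli_pmf \<delta>) =
      bind_pmf R (\<lambda>f. bind_pmf (bernoulli_pmf \<delta>) (\<lambda>y. return_pmf (f(e := y))))"
    unfolding R_def
    by (subst ins, subst Pi_pmf_insert)
       (auto simp: finite_pairs pair_pmf_def map_bind_pmf bind_commute_pmf[of "bernoulli_pmf \<delta>"])
  then have cor: "corruption \<delta> n =
      bind_pmf R (\<lambda>f. bind_pmf (bernoulli_pmf \<delta>)
        (\<lambda>y. return_pmf (if y then insert e (L f) else L f)))"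
    by (simp only: corruption_def map_bind_pmf map_return_pmf L)
  have 1: "bind_pmf (corruption \<delta> n) (\<lambda>K. F (insert e K)) = bind_pmf R (\<lambda>f. F (insert e (L f)))"
    by (simp add: cor bind_assoc_pmf bind_return_pmf if_distrib[of "insert e"] cong: if_cong)
  have 2: "bind_pmf (corruption \<delta> n) F =
      bind_pmf R (\<lambda>f. bind_pmf (bernoulli_pmf \<delta>) (\<lambda>y. F (if y then insert e (L f) else L f)))"
    by (simp add: cor bind_assoc_pmf bind_return_pmf)
  have "\<delta> * measure_pmf.expectation R (\<lambda>f. measure_pmf.prob (F (insert e (L f))) T)
     \<le> measure_pmf.expectation R (\<lambda>f. measure_pmf.prob
         (bind_pmf (bernoulli_pmf \<delta>) (\<lambda>y. F (if y then insert e (L f) else L f))) T)"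
    unfolding integral_mult_right_zero[symmetric]
  proof (intro integral_mono measure_pmf.integrable_const_bound[where B = 1])
    fix f
    \<comment> \<open>Averaging over \<open>y\<close> gives \<delta> times the term for
      \<open>True\<close> plus a nonnegative term, which is dropped.\<close>
    show "\<delta> * measure_pmf.prob (F (insert e (L f))) T \<le> measure_pmf.prob
         (bind_pmf (bernoulli_pmf \<delta>) (\<lambda>y. F (if y then insert e (L f) else L f))) T"
      using \<delta> by (simp add: prob_bind_pmf)
  qed (use \<delta> in \<open>auto intro!: mult_le_one\<close>)
  then show ?thesis
    unfolding 1 2 prob_bind_pmf[of R] .
qed

section \<open>The hard instances\<close>

definition base_dist :: "nat \<Rightarrow> real \<Rightarrow> nat \<Rightarrow> nat \<Rightarrow> real" where
  "base_dist k s x y =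
     (if x = y then 0 else if x \<in> {1..k} \<or> y \<in> {1..k} then 1 else s)"

definition planted_dist :: "nat \<Rightarrow> real \<Rightarrow> nat \<Rightarrow> nat \<Rightarrow> nat \<Rightarrow> nat \<Rightarrow> real" where
  "planted_dist k s a b x y = (if {x, y} = {a, b} then s else base_dist k s x y)"

text \<open>The head is the index of the point itself; it tells the decoder which entry of the other
  row to read, and the \<open>Suc\<close> there skips the head.\<close>

definition row :: "nat \<Rightarrow> (nat \<Rightarrow> nat \<Rightarrow> real) \<Rightarrow> nat \<Rightarrow> symbol" where
  "row n d x = real x # map (d x) [0..<n]"

definition min_decoder :: "symbol \<Rightarrow> symbol \<Rightarrow> real" where
  "min_decoder u v = min (u ! Suc (nat \<lfloor>hd v\<rfloor>)) (v ! Suc (nat \<lfloor>hd u\<rfloor>))"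

lemma min_decoder_row:
  assumes "x < n" "y < n"
  shows "min_decoder (row n d x) (row n d' y) = min (d x y) (d' y x)"
  using assms by (simp add: min_decoder_def row_def)

lemma represents_row:
  assumes "\<And>x y. x < n \<Longrightarrow> y < n \<Longrightarrow> d x y = d y x"
  shows "represents n min_decoder (row n d) d"
  unfolding represents_def using assms by (simp add: min_decoder_row)

lemma decoder_min_decoder: "decoder n min_decoder"
  unfolding decoder_def
proof (intro allI impI)
  fix d assume "Metric_space {..<n} d"
  then have "\<And>x y. d x y = d y x" by (rule Metric_space.commute)
  then show "\<exists>SO. represents n min_decoder SO d" using represents_row by blast
qed

section \<open>Metric axioms and oracle answers of the instances\<close>

lemma base_dist_commute: "base_dist k s x y = base_dist k s y x"
  by (auto simp: base_dist_def)

lemma planted_dist_commute: "planted_dist k s a b x y = planted_dist k s a b y x"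
  by (auto simp: planted_dist_def base_dist_commute insert_commute)

lemma Metric_space_base_dist:
  assumes "0 < s" "s \<le> 1"
  shows "Metric_space M (base_dist k s)"
  using assms by unfold_locales (auto simp: base_dist_def)

text \<open>A third point is at distance 1 from both \<open>a\<close> and \<open>b\<close>, so a
  triangle through both has sides \<open>s\<close>, 1, 1. All other triangles are those of
  \<open>base_dist\<close>.\<close>

lemma Metric_space_planted_dist:
  assumes "0 < s" "s \<le> 1" "a \<in> {1..k}" "b \<in> {1..k}" "a \<noteq> b"
  shows "Metric_space M (planted_dist k s a b)"
proof
  let ?d = "planted_dist k s a b"
  have nn: "0 \<le> ?d x y" and le1: "?d x y \<le> 1" for x y
    using assms by (simp_all add: planted_dist_def base_dist_def)
  show "0 \<le> ?d x y" for x y by (rule nn)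
  show "?d x y = ?d y x" for x y by (rule planted_dist_commute)
  show "?d x y = 0 \<longleftrightarrow> x = y" for x y
    using assms by (auto simp: planted_dist_def base_dist_def)
  have far: "?d y z = 1" if "{x, y} = {a, b}" "z \<noteq> x" "z \<noteq> y" for x y z
  proof -
    have "y \<in> {1..k}" "{y, z} \<noteq> {a, b}" using that assms by (auto simp: doubleton_eq_iff)
    then show ?thesis using that(3) by (simp add: planted_dist_def base_dist_def)
  qed
  show "?d x z \<le> ?d x y + ?d y z" for x y z
  proof -
    consider "y = x \<or> y = z" | "x = z"
      | "y \<noteq> x" "y \<noteq> z" "x \<noteq> z" "{x, y} = {a, b}"
      | "y \<noteq> x" "y \<noteq> z" "x \<noteq> z" "{z, y} = {a, b}"
      | "y \<noteq> x" "y \<noteq> z" "x \<noteq> z" "{z, x} = {a, b}"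
      | "{x, z} \<noteq> {a, b}" "{x, y} \<noteq> {a, b}" "{y, z} \<noteq> {a, b}"
      by (metis insert_commute)
    then show ?thesis
    proof cases
      case 1
      then show ?thesis using nn by auto
    next
      case 2
      have "?d z z = 0" using assms by (auto simp: planted_dist_def base_dist_def)
      then show ?thesis using 2 nn[of x y] nn[of y z] by simp
    next
      case 3
      then show ?thesis using far[of x y z] nn[of x y] le1[of x z] by simp
    next
      case 4
      then show ?thesis
        using far[of z y x] nn[of y z] le1[of x z] planted_dist_commute[of k s a b x y] by simp
    next
      case 5
      then show ?thesis using far[of z x y] nn[of y z] le1[of x z] by simp
    next
      case 6
      have "base_dist k s x z \<le> base_dist k s x y + base_dist k s y z"
        using Metric_space.triangle[OF Metric_space_base_dist[of s UNIV k]] assms by simp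
      with 6 show ?thesis by (simp add: planted_dist_def)
    qed
  qed
qed

text \<open>The row of \<open>a\<close> still claims distance 1 to \<open>b\<close>; as
  \<open>s\<close> is at most 1, the minimum lets the single changed row prevail.\<close>

lemma represents_planted:
  assumes "s \<le> 1" "a \<in> {1..k}" "a \<noteq> b"
  shows "represents n min_decoder ((row n (base_dist k s))(b := row n (planted_dist k s a b) b))
    (planted_dist k s a b)"
  unfolding represents_def using assms
  by (auto simp: min_decoder_row planted_dist_def base_dist_def doubleton_eq_iff)

text \<open>The hidden pair shows \<open>s\<close> either way: as its true distance or as the value
  reported by the adversary.\<close>

lemma weak_oracle_planted:
  "weak_oracle (planted_dist k s a b) (\<lambda>_ _. s) K =
     weak_oracle (base_dist k s) (\<lambda>_ _. s) (insert {a, b} K)"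
  by (intro ext) (auto simp: weak_oracle_def planted_dist_def)

section \<open>Cheap solutions, uniformly in the three objectives\<close>

lemma cost_lt_one_imp_dist_lt_one:
  assumes "cost obj n d (S, f) < 1" "p < n" "\<And>x y. d x y \<ge> 0"
  shows "d p (f p) < 1"
proof (cases obj)
  case KCenter
  have "d p (f p) \<le> Max ((\<lambda>p. d p (f p)) ` {..<n})" using assms(2) by (intro Max_ge) auto
  with KCenter assms(1) show ?thesis by simp
next
  case KMedian
  have "d p (f p) \<le> (\<Sum>p<n. d p (f p))" using assms by (intro member_le_sum) auto
  with KMedian assms(1) show ?thesis by simp
next
  case KMeans
  have "(d p (f p))\<^sup>2 \<le> (\<Sum>p<n. (d p (f p))\<^sup>2)" using assms by (intro member_le_sum) auto
  with KMeans assms(1) have "(d p (f p))\<^sup>2 < 1" by simp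
  then show ?thesis using assms(3) by (simp add: power_less_one_iff)
qed

lemma cost_le_of_dist_le:
  assumes "\<And>p. p < n \<Longrightarrow> 0 \<le> d p (f p) \<and> d p (f p) \<le> s" "0 \<le> s" "s \<le> 1" "0 < n"
  shows "cost obj n d (S, f) \<le> real n * s"
proof (cases obj)
  case KCenter
  have "Max ((\<lambda>p. d p (f p)) ` {..<n}) \<le> s" using assms by (subst Max_le_iff) auto
  also have "s \<le> real n * s" using assms by (simp add: mult_le_cancel_right1)
  finally show ?thesis using KCenter by simp
next
  case KMedian
  have "(\<Sum>p<n. d p (f p)) \<le> (\<Sum>p<n. s)" using assms by (intro sum_mono) auto
  with KMedian show ?thesis by simp
next
  case KMeans
  have "(\<Sum>p<n. (d p (f p))\<^sup>2) \<le> (\<Sum>p<n. s)"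
  proof (rule sum_mono)
    fix p assume "p \<in> {..<n}"
    then have "0 \<le> d p (f p)" "d p (f p) \<le> s" using assms by auto
    then have "d p (f p) * d p (f p) \<le> s * 1" using assms by (intro mult_mono) auto
    then show "(d p (f p))\<^sup>2 \<le> s" by (simp add: power2_eq_square)
  qed
  with KMeans show ?thesis by simp
qed

lemma cost_nonneg:
  assumes "\<And>x y. d x y \<ge> 0" "0 < n"
  shows "0 \<le> cost obj n d sol"
proof (cases sol)
  case (Pair S f)
  have "d 0 (f 0) \<le> Max ((\<lambda>p. d p (f p)) ` {..<n})" using assms(2) by (intro Max_ge) auto
  then have "0 \<le> Max ((\<lambda>p. d p (f p)) ` {..<n})" using assms(1) order_trans by blast
  then show ?thesis using assms Pair by (cases obj) (auto intro: sum_nonneg)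
qed

lemma opt_planted_le:
  assumes "0 < s" "s \<le> 1" "a \<in> {1..k}" "b \<in> {1..k}" "a \<noteq> b" "k < n"
  shows "opt obj n k (planted_dist k s a b) \<le> real n * s"
proof -
  let ?d = "planted_dist k s a b"
  \<comment> \<open>Of the \<open>k + 1\<close> candidates 0 to \<open>k\<close>, dropping
    \<open>b\<close> leaves \<open>k\<close> centers: \<open>a\<close> serves \<open>b\<close>, and
    0 serves the tiny cluster.\<close>
  let ?f = "\<lambda>x. if x = b then a else if x \<le> k then x else 0"
  have nn: "\<And>x y. ?d x y \<ge> 0"
    using assms by (auto simp: planted_dist_def base_dist_def)
  have "({..k} - {b}, ?f) \<in> solutions n k"
    using assms by (auto simp: solutions_def)
  moreover have "bdd_below (cost obj n ?d ` solutions n k)"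
    using cost_nonneg[of ?d n obj] nn assms by (intro bdd_belowI[of _ 0]) auto
  ultimately have "opt obj n k ?d \<le> cost obj n ?d ({..k} - {b}, ?f)"
    unfolding opt_def by (intro cINF_lower)
  also have "\<dots> \<le> real n * s"
    using assms by (intro cost_le_of_dist_le) (auto simp: planted_dist_def base_dist_def)
  finally show ?thesis .
qed

text \<open>Otherwise \<open>1, \<dots>, k\<close> and the center serving \<open>0\<close> are \<open>k + 1\<close> different centers.\<close>

lemma cheap_solution_merges_planted_pair:
  assumes "0 < s" "s \<le> 1" "a \<in> {1..k}" "b \<in> {1..k}" "k < n"
    and sol: "(S, f) \<in> solutions n k"
    and cost: "cost obj n (planted_dist k s a b) (S, f) < 1"
  shows "f a = b \<or> f b = a"
proof (rule ccontr)
  assume neg: "\<not> (f a = b \<or> f b = a)"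
  let ?d = "planted_dist k s a b"
  have nn: "\<And>x y. ?d x y \<ge> 0"
    using assms by (auto simp: planted_dist_def base_dist_def)
  have lt: "?d p (f p) < 1" if "p < n" for p
    using cost_lt_one_imp_dist_lt_one[OF cost that nn] .
  have S: "S \<subseteq> {..<n}" "card S = k" "\<And>p. p < n \<Longrightarrow> f p \<in> S"
    using sol by (auto simp: solutions_def)
  \<comment> \<open>Apart from itself, a point of \<open>{1..k}\<close> has distance below 1 at most
    to its partner in the hidden pair, which \<open>neg\<close> rules out as its center.\<close>
  have "f p = p" if "p \<in> {1..k}" for p
    using lt[of p] that neg assms
    by (auto simp: planted_dist_def base_dist_def doubleton_eq_iff split: if_splits)
  then have "{1..k} \<subseteq> S" using S(3) \<open>k < n\<close> by (metis atLeastAtMost_iff le_less_trans subsetI)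
  moreover have "f 0 \<in> S" using S(3) assms by auto
  moreover have "f 0 \<notin> {1..k}"
    using lt[of 0] assms
    by (auto simp: planted_dist_def base_dist_def doubleton_eq_iff split: if_splits)
  moreover have "finite S" using S(1) finite_subset by blast
  ultimately have "card (insert (f 0) {1..k}) \<le> card S" by (intro card_mono) auto
  with \<open>f 0 \<notin> {1..k}\<close> S(2) show False by simp
qed

section \<open>Averaging over the hidden pair\<close>

text \<open>Pairs are ordered because only the second point has a changed row; querying the first
  point reveals nothing.\<close>

fun exposes :: "solution \<times> nat list \<times> (nat \<times> nat) list \<Rightarrow> nat \<times> nat \<Rightarrow> bool" where
  "exposes ((S, f), P, E) (a, b) \<longleftrightarrow>
     f a = b \<or> f b = a \<or> b \<in> set P \<or> (a, b) \<in> set E \<or> (b, a) \<in> set E"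

text \<open>The assignment is a function, so the output accounts for at most two pairs per point of
  \<open>C\<close>. A point query adds at most \<open>card C\<close> pairs, an edge query at most
  two.\<close>

lemma card_exposes_le:
  assumes "finite C" "D \<subseteq> C \<times> C"
  shows "card {q \<in> D. exposes ((S, f), P, E) q}
    \<le> 2 * card C + card C * length P + 2 * length E"
proof -
  have "{q \<in> D. exposes ((S, f), P, E) q} \<subseteq>
      ((\<lambda>a. (a, f a)) ` C \<union> (\<lambda>b. (f b, b)) ` C) \<union> C \<times> set P \<union> (set E \<union> prod.swap ` set E)"
    using assms(2) by (force simp: image_iff)
  then have "card {q \<in> D. exposes ((S, f), P, E) q} \<le>
      card (((\<lambda>a. (a, f a)) ` C \<union> (\<lambda>b. (f b, b)) ` C) \<union> C \<times> set P \<union> (set E \<union> prod.swap ` set E))"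
    using assms by (intro card_mono) auto
  also have "\<dots> \<le> ((card C + card C) + card C * length P) + (length E + length E)"
    using assms
    by (intro order_trans[OF card_Un_le] add_mono order_trans[OF card_image_le])
       (auto simp: card_cartesian_product card_length)
  finally show ?thesis by simp
qed

text \<open>By linearity the sum is the expected number of \<open>q\<close> in \<open>D\<close> with
  \<open>R q x\<close>.\<close>

lemma sum_prob_le:
  assumes "finite D" "\<And>x. x \<in> set_pmf M \<Longrightarrow> real (card {q \<in> D. R q x}) \<le> B"
  shows "(\<Sum>q\<in>D. measure_pmf.prob M {x. R q x}) \<le> B"
proof -
  have int: "integrable M (indicat_real {x. R q x})" for q
    by (intro measure_pmf.integrable_const_bound[where B = 1]) (auto simp: indicator_def)
  have "(\<Sum>q\<in>D. measure_pmf.prob M {x. R q x})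
      = measure_pmf.expectation M (\<lambda>x. \<Sum>q\<in>D. indicat_real {x. R q x} x)"
    using int by (subst Bochner_Integration.integral_sum) auto
  also have "(\<lambda>x. \<Sum>q\<in>D. indicat_real {x. R q x} x) = (\<lambda>x. real (card {q \<in> D. R q x}))"
    using assms(1) by (auto simp: indicator_def sum.If_cases Int_def)
  also have "measure_pmf.expectation M (\<lambda>x. real (card {q \<in> D. R q x})) \<le> B"
  proof (rule measure_pmf.integral_le_const)
    show "integrable M (\<lambda>x. real (card {q \<in> D. R q x}))"
      using assms(1)
      by (intro measure_pmf.integrable_const_bound[where B = "real (card D)"])
         (auto intro: card_mono)
    show "AE x in M. real (card {q \<in> D. R q x}) \<le> B"
      using assms(2) by (auto simp: AE_measure_pmf_iff)
  qed
  finally show ?thesis .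
qed

text \<open>Here \<open>s\<close> is chosen so small that \<open>c\<close> times the optimal cost \<open>n * s\<close> stays below 1.\<close>

lemma lower_bound:
  assumes "0 < c" "k < n" "2 \<le> k" and \<delta>: "0 < \<delta>" "\<delta> < 1"
    and approx: "approximates obj c \<delta> n k A"
    and few: "\<And>p e. (p, e) \<in> query_counts \<delta> n A \<Longrightarrow> real p \<le> p0 \<and> real e \<le> e0"
  shows "\<delta> * (real k * (real k - 1)) / 2 \<le> 2 * real k + real k * p0 + 2 * e0"
proof -
  define s where "s = 1 / (c * real n + 1)"
  have pos: "c * real n > 0" using assms by simp
  then have s: "0 < s" "s \<le> 1" "c * (real n * s) < 1"
    by (auto simp: s_def field_simps)
  define adv :: adversary where "adv = (\<lambda>_ _. s)"
  define d where "d = base_dist k s"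
  define SO where "SO = row n d"
  define alg where "alg = A min_decoder"
  \<comment> \<open>This reference run on the base metric does not depend on the hidden pair, so all
    pairs can be compared with it.\<close>
  define F where "F K = trace (weak_oracle d adv K) SO d alg" for K
  define D where "D = {(a, b). a \<in> {1..k} \<and> b \<in> {1..k} \<and> a \<noteq> b}"
  have D: "D = {1..k} \<times> {1..k} - Id_on {1..k}" by (auto simp: D_def)
  have "card D = k * k - k"
    unfolding D by (subst card_Diff_subset) (auto simp: Id_on_def card_cartesian_product card_UN_disjoint)
  then have cardD: "real (card D) = real k * (real k - 1)"
    using assms by (simp add: of_nat_diff algebra_simps)
  \<comment> \<open>Success probability 1/2 on the instance of \<open>q\<close> carries over to the
    reference run at the price of a factor \<delta> for having the pair corrupted.\<close>
  have hidden: "\<delta> / 2 \<le> measure_pmf.prob (bind_pmf (corruption \<delta> n) F)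
      {x. exposes x q}" if "q \<in> D" for q
  proof -
    obtain a b where q: "q = (a, b)" by force
    with that have ab: "a \<in> {1..k}" "b \<in> {1..k}" "a \<noteq> b" by (auto simp: D_def)
    with \<open>k < n\<close> have pair: "{a, b} \<in> pairs n"
      unfolding pairs_def by (intro CollectI exI[of _ a] exI[of _ b]) auto
    define d' where "d' = planted_dist k s a b"
    define SO' where "SO' = SO(b := row n d' b)"
    define good where "good sol \<longleftrightarrow> sol \<in> solutions n k \<and> cost obj n d' sol \<le> c * opt obj n k d'"
      for sol
    have good: "snd sol a = b \<or> snd sol b = a" if "good sol" for sol
    proof -
      have "c * opt obj n k d' \<le> c * (real n * s)"
        unfolding d'_def using ab s assms by (intro mult_left_mono opt_planted_le) auto
      with that s have "cost obj n d' sol < 1" "sol \<in> solutions n k" by (auto simp: good_def)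
      then show ?thesis
        using cheap_solution_merges_planted_pair[of s a k b n "fst sol" "snd sol" obj] ab s assms
        by (auto simp: d'_def)
    qed
    have step: "measure_pmf.prob (run (weak_oracle d' adv K) SO' d' alg) {(s, p, e). good s}
       \<le> measure_pmf.prob (F (insert {a, b} K)) {x. exposes x q}" for K
    proof -
      have "measure_pmf.prob (run (weak_oracle d' adv K) SO' d' alg) {(s, p, e). good s}
         \<le> measure_pmf.prob (trace (weak_oracle d' adv K) SO d alg)
          {(s, P, E). good s \<or> b \<in> set P \<or> (a, b) \<in> set E \<or> (b, a) \<in> set E}"
        by (rule prob_run_le_prob_trace) (auto simp: SO'_def d'_def d_def planted_dist_def)
      also have "\<dots> = measure_pmf.prob (F (insert {a, b} K))
          {(s, P, E). good s \<or> b \<in> set P \<or> (a, b) \<in> set E \<or> (b, a) \<in> set E}"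
        by (simp add: F_def d'_def d_def adv_def weak_oracle_planted)
      also have "\<dots> \<le> measure_pmf.prob (F (insert {a, b} K)) {x. exposes x q}"
        by (intro measure_pmf.finite_measure_mono) (auto simp: q dest!: good)
      finally show ?thesis .
    qed
    have "Metric_space {..<n} d'" "represents n min_decoder SO' d'"
      unfolding d'_def SO'_def SO_def d_def
      by (rule Metric_space_planted_dist represents_planted; use ab s in simp)+
    then have "decoder n min_decoder \<and> Metric_space {..<n} d' \<and> represents n min_decoder SO' d'"
      using decoder_min_decoder by blast
    from approx[unfolded approximates_def, rule_format, OF this, folded alg_def good_def]
    have "1 / 2 \<le> measure_pmf.prob (execution \<delta> n d' SO' adv alg) {(s, p, e). good s}" .
    also have "\<dots> \<le> measure_pmf.prob (bind_pmf (corruption \<delta> n) (\<lambda>K. F (insert {a, b} K))) {x. exposes x q}"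
      unfolding execution_def by (intro prob_bind_pmf_mono step)
    finally have "\<delta> * (1 / 2) \<le> \<delta> * measure_pmf.prob
        (bind_pmf (corruption \<delta> n) (\<lambda>K. F (insert {a, b} K))) {x. exposes x q}"
      using \<delta> by (intro mult_left_mono) auto
    also have "\<dots> \<le> measure_pmf.prob (bind_pmf (corruption \<delta> n) F) {x. exposes x q}"
      using \<delta> pair by (intro prob_corruption_insert_le) auto
    finally show ?thesis by simp
  qed
  have exec: "execution \<delta> n d SO adv alg =
      map_pmf (\<lambda>(s, P, E). (s, length P, length E)) (bind_pmf (corruption \<delta> n) F)"
    by (simp add: execution_def F_def map_bind_pmf run_eq_map_trace)
  have "\<delta> * (real k * (real k - 1)) / 2 = (\<Sum>q\<in>D. \<delta> / 2)" by (simp add: cardD)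
  also have "\<dots> \<le> (\<Sum>q\<in>D. measure_pmf.prob (bind_pmf (corruption \<delta> n) F)
      {x. exposes x q})"
    by (intro sum_mono hidden)
  also have "\<dots> \<le> 2 * real k + real k * p0 + 2 * e0"
  proof (rule sum_prob_le)
    show "finite D" by (simp add: D)
    fix x assume x: "x \<in> set_pmf (bind_pmf (corruption \<delta> n) F)"
    obtain S f P E where xe: "x = ((S, f), P, E)" by (cases x, cases "fst x") auto
    have "(\<lambda>(s, P, E). (s, length P, length E)) x \<in> set_pmf (execution \<delta> n d SO adv alg)"
      unfolding exec set_map_pmf using x by (rule imageI)
    then have "((S, f), length P, length E) \<in> set_pmf (execution \<delta> n d SO adv (A min_decoder))"
      by (simp add: xe alg_def)
    \<comment> \<open>The base metric is itself a legal input, so the assumed query bounds apply to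
      the reference run.\<close>
    moreover have "Metric_space {..<n} d" "represents n min_decoder SO d"
      using s by (simp_all add: d_def SO_def Metric_space_base_dist represents_row base_dist_commute)
    ultimately have "(length P, length E) \<in> query_counts \<delta> n A"
      unfolding query_counts_def
      by (intro CollectI case_prodI exI conjI) (assumption | rule decoder_min_decoder)+
    then have few': "real (length P) \<le> p0" "real (length E) \<le> e0" using few by simp_all
    have "card {q \<in> D. exposes ((S, f), P, E) q} \<le> 2 * k + k * length P + 2 * length E"
      using card_exposes_le[of "{1..k}" D S f P E] by (auto simp: D)
    then have "real (card {q \<in> D. exposes ((S, f), P, E) q})
        \<le> real (2 * k + k * length P + 2 * length E)" by (rule of_nat_mono)
    also have "\<dots> \<le> 2 * real k + real k * p0 + 2 * e0"
      using few' by (auto intro!: add_mono mult_left_mono)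
    finally show "real (card {q \<in> D. exposes x q})
        \<le> 2 * real k + real k * p0 + 2 * e0" by (simp add: xe)
  qed
  finally show ?thesis .
qed

theorem theorem6p1:
  "\<exists>(\<epsilon>::real) (k0::nat). \<epsilon> > 0 \<and>
     (\<forall>(c::real) (k::nat) (n::nat) (obj::objective) (A :: (symbol \<Rightarrow> symbol \<Rightarrow> real) \<Rightarrow> algorithm).
        c > 0 \<and> k \<ge> k0 \<and> n > k \<and> approximates obj c (1 / 3) n k A \<longrightarrow>
          (\<exists>(p, e) \<in> query_counts (1 / 3) n A.
             real p \<ge> \<epsilon> * real k \<or> real e \<ge> \<epsilon> * (real k)\<^sup>2))"
proof (intro exI[of _ "1 / 36"] exI[of _ 30] conjI allI impI)
  fix c :: real and k n :: nat and obj :: objective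
    and A :: "(symbol \<Rightarrow> symbol \<Rightarrow> real) \<Rightarrow> algorithm"
  assume asm: "c > 0 \<and> k \<ge> 30 \<and> n > k \<and> approximates obj c (1 / 3) n k A"
  show "\<exists>(p, e) \<in> query_counts (1 / 3) n A.
     real p \<ge> 1 / 36 * real k \<or> real e \<ge> 1 / 36 * (real k)\<^sup>2"
  proof (rule ccontr)
    assume "\<not> ?thesis"
    then have few: "\<And>p e. (p, e) \<in> query_counts (1 / 3) n A \<Longrightarrow>
        real p \<le> 1 / 36 * real k \<and> real e \<le> 1 / 36 * (real k)\<^sup>2"
      by force
    \<comment> \<open>With 1/36 the quadratic terms on the right total \<open>k * k / 12\<close>,
      half of the \<open>k * k / 6\<close> on the left. What remains forces \<open>k\<close> to be
      at most 26, below the threshold 30.\<close>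
    have "1 / 3 * (real k * (real k - 1)) / 2
        \<le> 2 * real k + real k * (1 / 36 * real k) + 2 * (1 / 36 * (real k)\<^sup>2)"
      by (rule lower_bound[OF _ _ _ _ _ _ few]) (use asm in auto)
    then have "real k * real k \<le> 26 * real k"
      by (simp add: power2_eq_square field_simps)
    then show False using asm by (simp add: mult_le_cancel_right)
  qed
qed simp

end
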